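(* Let $(T,\mathcal{A},\mu)$ be a complete finite measure space and let $\varphi\colon T\times\mathbb{R}^n\to\overline{\mathbb{R}}$ be a normal integrand, with $\varphi_t:=\varphi(t,\cdot)$. Then the set-valued mapping $$t\mapsto \operatorname{gph}\widehat\partial\varphi_t:=\big\{(x,x^* )\in\mathbb{R}^{2n}\;\big|\;x^*\in\widehat\partial\varphi_t(x)\big\}$$ is graph measurable on $T$, i.e., the set $\{(t,x,x^* )\in T\times\mathbb{R}^n\times\mathbb{R}^n\mid x^*\in\widehat\partial\varphi_t(x)\}$ belongs to $\mathcal{A}\otimes\mathcal{B}(\mathbb{R}^{2n})$.
   Context: $\overline{\mathbb{R}}=[-\infty,\infty]$, $\|\cdot\|$ is the Euclidean norm, and $\mathcal{B}(\mathbb{R}^d)$ is the Borel $\sigma$-algebra. A function $\varphi\colon T\times\mathbb{R}^n\to\overline{\mathbb{R}}$ is a normal integrand if the multifunction $t\mapsto\operatorname{epi}\varphi_t=\{(x,\alpha)\in\mathbb{R}^{n+1}\mid \alpha\ge\varphi_t(x)\}$ is measurable with closed values; since the measure space is complete, equivalently $\varphi$ is $\mathcal{A}\otimes\mathcal{B}(\mathbb{R}^n)$-measurable and $\varphi_t$ is lower semicontinuous for every $t\in T$. For $\Omega\subset\mathbb{R}^d$ and $\bar x\in\Omega$, the regular (Fréchet) normal cone is $\widehat N(\bar x;\Omega):=\{x^*\in\mathbb{R}^d\mid \limsup_{x\to\bar x,\,x\in\Omega}\langle x^*,x-\bar x\rangle/\|x-\bar x\|\le 0\}$, and $\widehat N(\bar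 x;\Omega):=\emptyset$ if $\bar x\notin\Omega$. For $\psi\colon\mathbb{R}^n\to\overline{\mathbb{R}}$ and $\bar x$ with $\psi(\bar x)<\infty$, the regular subdifferential is $\widehat\partial\psi(\bar x):=\{x^*\in\mathbb{R}^n\mid (x^*,-1)\in\widehat N((\bar x,\psi(\bar x));\operatorname{epi}\psi)\}$; it is empty when $\psi(\bar x)$ is not finite. A set-valued mapping $M\colon T\rightrightarrows\mathbb{R}^d$ is graph measurable if $\{(t,z)\mid z\in M(t)\}\in\mathcal{A}\otimes\mathcal{B}(\mathbb{R}^d)$. *)

theory Defs
  imports "HOL-Analysis.Analysis"
begin

definition epi :: "('b \<Rightarrow> ereal) \<Rightarrow> ('b \<times> real) set"
  where "epi \<psi> = {(x, \<alpha>). \<psi> x \<le> ereal \<alpha>}"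

text \<open>
  The measurability of a multifunction is that of Rockafellar and Wets: preimages
  of open sets are measurable. Multifunctions are only looked at on the space of the measure.
\<close>

definition measurable_multifunction ::
    "'t measure \<Rightarrow> ('t \<Rightarrow> 'b::topological_space set) \<Rightarrow> bool"
  where "measurable_multifunction M F \<longleftrightarrow>
    (\<forall>U. open U \<longrightarrow> {t \<in> space M. F t \<inter> U \<noteq> {}} \<in> sets M)"

definition normal_integrand ::
    "'t measure \<Rightarrow> ('t \<Rightarrow> 'b::topological_space \<Rightarrow> ereal) \<Rightarrow> bool"
  where "normal_integrand M \<phi> \<longleftrightarrow>
    measurable_multifunction M (\<lambda>t. epi (\<phi> t)) \<and>
    (\<forall>t\<in>space M. closed (epi (\<phi> t)))"

text \<open>
  The upper limit is taken in the extended reals over points of \<open>\<Omega>\<close> different from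
  \<open>x\<close>. At an isolated point of \<open>\<Omega>\<close> it is the upper limit along the trivial filter, which is
  \<open>-\<infinity>\<close>, and every vector is normal.
\<close>

definition regular_normal_cone :: "'b::real_inner \<Rightarrow> 'b set \<Rightarrow> 'b set"
  where "regular_normal_cone x \<Omega> =
    (if x \<in> \<Omega>
     then {v. Limsup (at x within \<Omega>) (\<lambda>y. ereal (inner v (y - x) / norm (y - x))) \<le> 0}
     else {})"

text \<open>
  The inner product and norm on a product type such as \<open>'b \<times> real\<close> are the Euclidean ones.
\<close>

definition regular_subdifferential :: "('b::real_inner \<Rightarrow> ereal) \<Rightarrow> 'b \<Rightarrow> 'b set"
  where "regular_subdifferential \<psi> x =
    (if \<bar>\<psi> x\<bar> \<noteq> \<infinity>
     then {v. (v, - 1) \<in> regular_normal_cone (x, real_of_ereal (\<psi> x)) (epi \<psi>)}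
     else {})"

definition gph :: "('b \<Rightarrow> 'c set) \<Rightarrow> ('b \<times> 'c) set"
  where "gph F = {(x, y). y \<in> F x}"

definition graph_measurable ::
    "'t measure \<Rightarrow> ('t \<Rightarrow> 'b::topological_space set) \<Rightarrow> bool"
  where "graph_measurable M F \<longleftrightarrow>
    {(t, z). t \<in> space M \<and> z \<in> F t} \<in> sets (M \<Otimes>\<^sub>M borel)"

end

theory Submission
  imports Defs
begin

text \<open>
  The difficulty is the uncountable quantifier over the points of the epigraph. It can be made
  countable because it always asks for a point in an \<^emph>\<open>open\<close> set. A measurable multifunction \<open>F\<close>
  decides by definition whether \<open>F t\<close> meets a fixed open set. If the open set depends on a
  parameter \<open>p\<close> as the section of an open set \<open>W\<close> in a product, then \<open>W\<close> is a countable union of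
  open rectangles \<open>B \<times> C\<close>, and \<open>F t\<close> meets the section over \<open>p\<close> if and only if \<open>p \<in> B\<close> and \<open>F t\<close>
  meets \<open>C\<close> for one of them. Hence the set of the pairs \<open>(t, p)\<close> with this property is measurable
  (lemma \<open>measurable_multifunction_meets_open_section\<close>).

  This is used twice. Since the epigraphs are closed, \<open>\<phi> t x \<le> a\<close> says that \<open>epi (\<phi> t)\<close> meets
  all balls around \<open>(x, a)\<close> of radius \<open>1 / Suc m\<close>, so that \<open>\<phi>\<close> is jointly measurable. And
  if \<open>\<phi> t x\<close> is a real number \<open>r\<close>, then \<open>v\<close> fails to be a regular subgradient at \<open>x\<close> exactly if,
  for some \<open>k\<close> and all \<open>m\<close>, the epigraph meets the set of the points \<open>z \<noteq> (x, r)\<close> within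
  \<open>1 / Suc m\<close> of \<open>(x, r)\<close> whose difference quotient in the direction \<open>(v, -1)\<close> exceeds
  \<open>1 / Suc k\<close>. With the strict inequality this set is open jointly in \<open>(x, r, v)\<close> and \<open>z\<close>, and
  \<open>(t, x, v) \<mapsto> (x, \<phi> t x, v)\<close> is measurable by the first step.
\<close>

text \<open>
  The parameter is a measurable function \<open>p\<close> on some space \<open>N\<close> over \<open>M\<close>, so that it may itself
  involve the multifunction, as the value \<open>\<phi> t x\<close> does below.
\<close>

lemma measurable_multifunction_meets_open_section:
  fixes F :: "'t \<Rightarrow> 'b::second_countable_topology set"
    and p :: "'s \<Rightarrow> 'p::second_countable_topology"
  assumes F: "measurable_multifunction M F"
    and \<tau>: "\<tau> \<in> measurable N M" and p: "p \<in> borel_measurable N"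
    and W: "open W"
  shows "{\<omega> \<in> space N. \<exists>z\<in>F (\<tau> \<omega>). (p \<omega>, z) \<in> W} \<in> sets N"
proof -
  obtain \<B> :: "'p set set" where \<B>: "countable \<B>" "topological_basis \<B>"
    using ex_countable_basis by blast
  obtain \<C> :: "'b set set" where \<C>: "countable \<C>" "topological_basis \<C>"
    using ex_countable_basis by blast
  define R where "R = {(B, C). B \<in> \<B> \<and> C \<in> \<C> \<and> B \<times> C \<subseteq> W}"
  have "countable R"
    by (rule countable_subset[of _ "\<B> \<times> \<C>"]) (auto simp: R_def \<B> \<C>)
  have opens: "open B" "open C" if "(B, C) \<in> R" for B C
    using that \<B> \<C> by (auto simp: R_def topological_basis_open)
  have cover: "\<exists>(B, C)\<in>R. y \<in> B \<and> z \<in> C" if yz: "(y, z) \<in> W" for y z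
  proof -
    obtain U V where UV: "open U" "open V" "y \<in> U" "z \<in> V" "U \<times> V \<subseteq> W"
      using W yz by (metis open_prod_elim mem_Sigma_iff)
    obtain B where B: "B \<in> \<B>" "y \<in> B" "B \<subseteq> U"
      using topological_basisE[OF \<B>(2) UV(1,3)] by blast
    obtain C where C: "C \<in> \<C>" "z \<in> C" "C \<subseteq> V"
      using topological_basisE[OF \<C>(2) UV(2,4)] by blast
    have "(B, C) \<in> R" using B C UV by (auto simp: R_def)
    then show ?thesis using B C by blast
  qed
  have "{\<omega> \<in> space N. \<exists>z\<in>F (\<tau> \<omega>). (p \<omega>, z) \<in> W} =
      (\<Union>(B, C)\<in>R. (p -` B \<inter> space N) \<inter> (\<tau> -` {t \<in> space M. F t \<inter> C \<noteq> {}} \<inter> space N))"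
    (is "?L = ?R")
  proof
    show "?L \<subseteq> ?R"
      using cover measurable_space[OF \<tau>] by fast
    show "?R \<subseteq> ?L"
      by (auto simp: R_def)
  qed
  also have "\<dots> \<in> sets N"
  proof (rule sets.countable_UN''[OF \<open>countable R\<close>], clarify)
    fix B C assume "(B, C) \<in> R"
    then have "open B" "open C" by (auto dest: opens)
    have "p -` B \<inter> space N \<in> sets N"
      using measurable_sets[OF p] \<open>open B\<close> by simp
    moreover have "{t \<in> space M. F t \<inter> C \<noteq> {}} \<in> sets M"
      using F \<open>open C\<close> by (auto simp: measurable_multifunction_def)
    ultimately show "p -` B \<inter> space N \<inter> (\<tau> -` {t \<in> space M. F t \<inter> C \<noteq> {}} \<inter> space N) \<in> sets N"
      using measurable_sets[OF \<tau>] by blast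
  qed
  finally show ?thesis .
qed

lemma ex_inverse_Suc_radius_iff:
  assumes "\<And>d e. P d \<Longrightarrow> 0 < e \<Longrightarrow> e \<le> d \<Longrightarrow> P e"
  shows "(\<exists>d>0. P d) \<longleftrightarrow> (\<exists>m. P (1 / real (Suc m)))"
proof
  assume "\<exists>d>0. P d"
  then obtain d where d: "d > 0" "P d" by blast
  then obtain m where "1 / real (Suc m) < d" using nat_approx_posE by blast
  then show "\<exists>m. P (1 / real (Suc m))"
    using assms[OF d(2), of "1 / real (Suc m)"] by (auto simp del: of_nat_Suc)
next
  assume "\<exists>m. P (1 / real (Suc m))"
  then obtain m where "P (1 / real (Suc m))" ..
  moreover have "1 / real (Suc m) > 0" by simp
  ultimately show "\<exists>d>0. P d" by blast
qed

lemma normal_integrand_borel_measurable: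
  fixes \<phi> :: "'t \<Rightarrow> 'b::{metric_space, second_countable_topology} \<Rightarrow> ereal"
  assumes \<phi>: "normal_integrand M \<phi>"
  shows "(\<lambda>(t, x). \<phi> t x) \<in> borel_measurable (M \<Otimes>\<^sub>M borel)"
proof -
  have mm: "measurable_multifunction M (\<lambda>t. epi (\<phi> t))"
    using \<phi> by (simp add: normal_integrand_def)
  have real_level: "{\<omega> \<in> space (M \<Otimes>\<^sub>M borel). \<phi> (fst \<omega>) (snd \<omega>) \<le> ereal a} \<in> sets (M \<Otimes>\<^sub>M borel)"
    for a
  proof -
    define W :: "nat \<Rightarrow> ('b \<times> 'b \<times> real) set"
      where "W m = {(x, z). dist z (x, a) < 1 / real (Suc m)}" for m
    have "open (W m)" for m
      unfolding W_def case_prod_unfold by (intro open_Collect_less continuous_intros)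
    have iff: "\<phi> t x \<le> ereal a \<longleftrightarrow> (\<forall>m. \<exists>z\<in>epi (\<phi> t). (x, z) \<in> W m)"
      if "t \<in> space M" for t x
    proof -
      have "closed (epi (\<phi> t))"
        using \<phi> that by (simp add: normal_integrand_def)
      then have "\<phi> t x \<le> ereal a \<longleftrightarrow> (x, a) \<in> closure (epi (\<phi> t))"
        by (simp add: closure_closed epi_def)
      also have "\<dots> \<longleftrightarrow> (\<forall>m. \<exists>z\<in>epi (\<phi> t). dist z (x, a) < 1 / real (Suc m))"
      proof -
        have "(\<exists>d>0. \<forall>z\<in>epi (\<phi> t). \<not> dist z (x, a) < d) \<longleftrightarrow>
            (\<exists>m. \<forall>z\<in>epi (\<phi> t). \<not> dist z (x, a) < 1 / real (Suc m))"
          by (rule ex_inverse_Suc_radius_iff) force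
        then show ?thesis unfolding closure_approachable by blast
      qed
      finally show ?thesis by (simp add: W_def)
    qed
    have "{\<omega> \<in> space (M \<Otimes>\<^sub>M borel). \<exists>z\<in>epi (\<phi> (fst \<omega>)). (snd \<omega>, z) \<in> W m}
        \<in> sets (M \<Otimes>\<^sub>M borel)" for m
      by (rule measurable_multifunction_meets_open_section[OF mm _ _ \<open>open (W m)\<close>]) measurable
    then have "{\<omega> \<in> space (M \<Otimes>\<^sub>M borel). \<forall>m. \<exists>z\<in>epi (\<phi> (fst \<omega>)). (snd \<omega>, z) \<in> W m}
        \<in> sets (M \<Otimes>\<^sub>M borel)"
      by (rule sets.sets_Collect_countable_All)
    also have "{\<omega> \<in> space (M \<Otimes>\<^sub>M borel). \<forall>m. \<exists>z\<in>epi (\<phi> (fst \<omega>)). (snd \<omega>, z) \<in> W m} =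
        {\<omega> \<in> space (M \<Otimes>\<^sub>M borel). \<phi> (fst \<omega>) (snd \<omega>) \<le> ereal a}"
      using iff by (auto simp: space_pair_measure)
    finally show ?thesis .
  qed
  have "(\<lambda>\<omega>. \<phi> (fst \<omega>) (snd \<omega>)) \<in> borel_measurable (M \<Otimes>\<^sub>M borel)"
    unfolding borel_measurable_iff_Iic_ereal
  proof
    fix b :: ereal
    have "{\<omega> \<in> space (M \<Otimes>\<^sub>M borel). \<phi> (fst \<omega>) (snd \<omega>) \<le> b} \<in> sets (M \<Otimes>\<^sub>M borel)"
    proof (cases b)
      case (real a)
      then show ?thesis using real_level by simp
    next
      case PInf
      then show ?thesis by simp
    next
      case MInf
      have "y \<le> - \<infinity> \<longleftrightarrow> (\<forall>n::nat. y \<le> ereal (- real n))" for y :: ereal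
      proof (cases y)
        case (real r)
        obtain n :: nat where "- r < real n" using reals_Archimedean2 by blast
        then show ?thesis using real by (auto simp: not_le intro!: exI[of _ n])
      qed auto
      then show ?thesis
        unfolding MInf by (simp only:) (intro sets.sets_Collect_countable_All real_level)
    qed
    then show "(\<lambda>\<omega>. \<phi> (fst \<omega>) (snd \<omega>)) -` {..b} \<inter> space (M \<Otimes>\<^sub>M borel) \<in> sets (M \<Otimes>\<^sub>M borel)"
      by (simp add: vimage_def Int_def conj_commute)
  qed
  then show ?thesis by (simp add: case_prod_unfold)
qed

lemma Limsup_le_zero_iff_eventually_le_inverse_Suc:
  fixes f :: "'a \<Rightarrow> real"
  shows "Limsup F (\<lambda>y. ereal (f y)) \<le> 0 \<longleftrightarrow> (\<forall>k. \<forall>\<^sub>F y in F. f y \<le> 1 / real (Suc k))"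
proof
  assume *: "Limsup F (\<lambda>y. ereal (f y)) \<le> 0"
  show "\<forall>k. \<forall>\<^sub>F y in F. f y \<le> 1 / real (Suc k)"
  proof
    fix k
    have "Limsup F (\<lambda>y. ereal (f y)) < ereal (1 / real (Suc k))"
      using * by (rule le_less_trans) simp
    then have "\<forall>\<^sub>F y in F. ereal (f y) < ereal (1 / real (Suc k))"
      by (rule Limsup_lessD)
    then show "\<forall>\<^sub>F y in F. f y \<le> 1 / real (Suc k)"
      by (rule eventually_mono) simp
  qed
next
  assume *: "\<forall>k. \<forall>\<^sub>F y in F. f y \<le> 1 / real (Suc k)"
  show "Limsup F (\<lambda>y. ereal (f y)) \<le> 0"
  proof (rule ereal_le_epsilon2)
    fix e :: real assume "0 < e"
    then obtain k where k: "1 / real (Suc k) < e" by (rule nat_approx_posE)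
    have "Limsup F (\<lambda>y. ereal (f y)) \<le> ereal e"
      by (rule Limsup_bounded, rule eventually_mono[OF *[rule_format, of k]]) (use k in simp)
    then show "Limsup F (\<lambda>y. ereal (f y)) \<le> 0 + ereal e" by simp
  qed
qed

text \<open>
  The negated form, with the quotient cleared of its denominator: the three conditions on \<open>y\<close>
  are strict or an inequation, so that they define an open set.
\<close>

lemma not_mem_regular_normal_cone_iff:
  assumes "x \<in> \<Omega>"
  shows "v \<notin> regular_normal_cone x \<Omega> \<longleftrightarrow>
    (\<exists>k. \<forall>m. \<exists>y\<in>\<Omega>. y \<noteq> x \<and> dist y x < 1 / real (Suc m) \<and>
      norm (y - x) / real (Suc k) < inner v (y - x))"
proof -
  have ev: "(\<forall>\<^sub>F y in at x within \<Omega>. P y) \<longleftrightarrow>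
      (\<exists>m. \<forall>y\<in>\<Omega>. y \<noteq> x \<and> dist y x < 1 / real (Suc m) \<longrightarrow> P y)" for P
    unfolding eventually_at
    by (rule ex_inverse_Suc_radius_iff) auto
  have quot: "\<not> inner v (y - x) / norm (y - x) \<le> 1 / real (Suc k) \<longleftrightarrow>
      norm (y - x) / real (Suc k) < inner v (y - x)" if "y \<noteq> x" for y k
    using that by (simp add: not_le field_simps del: of_nat_Suc)
  have "v \<notin> regular_normal_cone x \<Omega> \<longleftrightarrow>
      (\<exists>k. \<forall>m. \<exists>y\<in>\<Omega>. y \<noteq> x \<and> dist y x < 1 / real (Suc m) \<and>
        \<not> inner v (y - x) / norm (y - x) \<le> 1 / real (Suc k))"
    using assms
    by (simp add: regular_normal_cone_def Limsup_le_zero_iff_eventually_le_inverse_Suc ev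
        del: of_nat_Suc)
  then show ?thesis using quot by meson
qed

theorem theorem3p2:
  fixes M :: "'t measure" and \<phi> :: "'t \<Rightarrow> real ^ 'n \<Rightarrow> ereal"
  assumes "complete_measure M" and "finite_measure M"
    and "normal_integrand M \<phi>"
  shows "graph_measurable M (\<lambda>t. gph (regular_subdifferential (\<phi> t)))"
proof -
  let ?N = "M \<Otimes>\<^sub>M (borel :: ((real ^ 'n) \<times> (real ^ 'n)) measure)"
  define f where "f \<omega> = \<phi> (fst \<omega>) (fst (snd \<omega>))" for \<omega> :: "'t \<times> (real ^ 'n) \<times> (real ^ 'n)"
  \<comment> \<open>Where \<open>f \<omega>\<close> is infinite, \<open>real_of_ereal\<close> yields the default value 0; these \<open>\<omega>\<close> are excluded
    by the set \<open>finite_value\<close> below.\<close>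
  define p where "p \<omega> = ((fst (snd \<omega>), real_of_ereal (f \<omega>)), snd (snd \<omega>))" for \<omega>
  define W :: "nat \<Rightarrow> nat \<Rightarrow> ((((real ^ 'n) \<times> real) \<times> (real ^ 'n)) \<times> ((real ^ 'n) \<times> real)) set"
    where "W k m = {(q, z). z \<noteq> fst q \<and> dist z (fst q) < 1 / real (Suc m) \<and>
      norm (z - fst q) / real (Suc k) < inner (snd q, - 1) (z - fst q)}" for k m
  have mm: "measurable_multifunction M (\<lambda>t. epi (\<phi> t))"
    using assms by (simp add: normal_integrand_def)
  have fst_borel: "fst \<in> borel_measurable (borel :: ((real ^ 'n) \<times> (real ^ 'n)) measure)"
    and snd_borel: "snd \<in> borel_measurable (borel :: ((real ^ 'n) \<times> (real ^ 'n)) measure)"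
    by (intro borel_measurable_continuous_onI continuous_intros)+
  have x_meas: "(\<lambda>\<omega>. fst (snd \<omega>)) \<in> borel_measurable ?N"
    and v_meas: "(\<lambda>\<omega>. snd (snd \<omega>)) \<in> borel_measurable ?N"
    using measurable_compose[OF measurable_snd fst_borel]
      measurable_compose[OF measurable_snd snd_borel] .
  have f_meas: "f \<in> borel_measurable ?N"
    using measurable_compose[OF measurable_Pair[OF measurable_fst x_meas]
        normal_integrand_borel_measurable[OF assms(3)]]
    by (simp add: f_def[abs_def])
  have p_meas: "p \<in> borel_measurable ?N"
    unfolding p_def[abs_def]
    by (intro borel_measurable_Pair x_meas v_meas borel_measurable_real_of_ereal f_meas)
  have "open (W k m)" for k m
    unfolding W_def case_prod_unfold
    by (intro open_Collect_conj open_Collect_less open_Collect_neq continuous_intros) auto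
  then have "{\<omega> \<in> space ?N. \<exists>z\<in>epi (\<phi> (fst \<omega>)). (p \<omega>, z) \<in> W k m} \<in> sets ?N" for k m
    using measurable_multifunction_meets_open_section[OF mm measurable_fst p_meas] by blast
  then have fails: "{\<omega> \<in> space ?N. \<exists>k. \<forall>m. \<exists>z\<in>epi (\<phi> (fst \<omega>)). (p \<omega>, z) \<in> W k m} \<in> sets ?N"
    by (intro sets.sets_Collect_countable_Ex sets.sets_Collect_countable_All)
  have finite_value: "{\<omega> \<in> space ?N. \<bar>f \<omega>\<bar> \<noteq> \<infinity>} \<in> sets ?N"
    using f_meas by measurable
  have "v \<in> regular_subdifferential (\<phi> t) x \<longleftrightarrow> \<bar>f (t, x, v)\<bar> \<noteq> \<infinity> \<and>
      \<not> (\<exists>k. \<forall>m. \<exists>z\<in>epi (\<phi> t). (p (t, x, v), z) \<in> W k m)" for t x v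
  proof (cases "\<bar>\<phi> t x\<bar> = \<infinity>")
    case True
    then show ?thesis by (simp add: regular_subdifferential_def f_def)
  next
    case False
    then have "(x, real_of_ereal (\<phi> t x)) \<in> epi (\<phi> t)"
      by (simp add: epi_def ereal_real)
    from not_mem_regular_normal_cone_iff[OF this, of "(v, - 1)"] False show ?thesis
      by (simp add: regular_subdifferential_def f_def p_def W_def del: of_nat_Suc) blast
  qed
  then have graph_eq: "{(t, z). t \<in> space M \<and> z \<in> gph (regular_subdifferential (\<phi> t))} =
      {\<omega> \<in> space ?N. \<bar>f \<omega>\<bar> \<noteq> \<infinity>} -
      {\<omega> \<in> space ?N. \<exists>k. \<forall>m. \<exists>z\<in>epi (\<phi> (fst \<omega>)). (p \<omega>, z) \<in> W k m}"
    by (simp add: space_pair_measure gph_def set_eq_iff cong: conj_cong)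
  show ?thesis
    unfolding graph_measurable_def graph_eq using finite_value fails by (rule sets.Diff)
qed

end
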